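(* In the square-loss game $(\Omega,\Gamma,\ell)=(\mathbb{R},\mathbb{R},\ell)$ with $\ell(\omega,\gamma)=(\omega-\gamma)^2$, played according to the competitive prediction protocol, Sceptic has a strategy that guarantees $$\lim_{N\to\infty}\left|\gamma^{[1]}_N-\gamma^{[2]}_N\right|=0\quad\text{or}\quad\lim_{N\to\infty}\max\left(L^{[1]}_N-\tilde L_N,\;L^{[2]}_N-\tilde L_N\right)=\infty .$$
   Context: A game of prediction is a triple $(\Omega,\Gamma,\ell)$ where $\Omega$ (outcome space) and $\Gamma$ (prediction space) are sets and $\ell:\Omega\times\Gamma\to\mathbb{R}$ is the loss function. Competitive prediction protocol (perfect information; players: Nature, Predictor 1, Predictor 2, Sceptic): at each step $n=1,2,\ldots$, first Predictor 1 and Predictor 2 announce $\gamma_n^{[1]}\in\Gamma$ and $\gamma_n^{[2]}\in\Gamma$; then Sceptic announces $\tilde\gamma_n\in\Gamma$; then Nature announces $\omega_n\in\Omega$. A strategy for Sceptic is a function determining $\tilde\gamma_n$ from all moves made before it (the outcomes and all predictions of the steps before $n$, together with $\gamma_n^{[1]},\gamma_n^{[2]}$). It guarantees a property if the property holds for all sequences of moves of the other players when Sceptic follows it. Cumulative losses: $L_N^{[k]}=\sum_{n=1}^N\ell(\omega_n,\gamma_n^{[k]})$ for $k=1,2$, and $\tilde L_N=\sum_{n=1}^N\ell(\omega_n,\tilde\gamma_n)$. *)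

theory Defs
  imports "HOL-Analysis.Analysis"
begin

record ('o, 'p) game =
  outcomes :: "'o set"
  predictions :: "'p set"
  loss :: "'o \<Rightarrow> 'p \<Rightarrow> real"

(* A round lists its moves in the order in which they are announced:
   Predictor 1, Predictor 2, Sceptic, Nature. *)
type_synonym ('o, 'p) round = "'p \<times> 'p \<times> 'p \<times> 'o"

(* The arguments are the completed rounds, earliest first, and the two predictions
   announced in the current round. *)
type_synonym ('o, 'p) strategy = "('o, 'p) round list \<Rightarrow> 'p \<Rightarrow> 'p \<Rightarrow> 'p"

definition sceptic_strategy :: "('o, 'p) game \<Rightarrow> ('o, 'p) strategy \<Rightarrow> bool" where
  "sceptic_strategy G \<sigma> \<longleftrightarrow>
     (\<forall>h p q.
        set h \<subseteq> predictions G \<times> predictions G \<times> predictions G \<times> outcomes G \<and>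
        p \<in> predictions G \<and> q \<in> predictions G \<longrightarrow> \<sigma> h p q \<in> predictions G)"

(* Steps are numbered from 1; the value of a sequence of moves at 0 is never used.
   The result consists of rounds 1, ..., n. *)
fun history ::
    "('o, 'p) strategy \<Rightarrow> (nat \<Rightarrow> 'p) \<Rightarrow> (nat \<Rightarrow> 'p) \<Rightarrow> (nat \<Rightarrow> 'o) \<Rightarrow> nat \<Rightarrow> ('o, 'p) round list"
  where
  "history \<sigma> \<gamma>1 \<gamma>2 \<omega> 0 = []"
| "history \<sigma> \<gamma>1 \<gamma>2 \<omega> (Suc n) =
     (let h = history \<sigma> \<gamma>1 \<gamma>2 \<omega> n
      in h @ [(\<gamma>1 (Suc n), \<gamma>2 (Suc n), \<sigma> h (\<gamma>1 (Suc n)) (\<gamma>2 (Suc n)), \<omega> (Suc n))])"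

definition sceptic_moves ::
    "('o, 'p) strategy \<Rightarrow> (nat \<Rightarrow> 'p) \<Rightarrow> (nat \<Rightarrow> 'p) \<Rightarrow> (nat \<Rightarrow> 'o) \<Rightarrow> nat \<Rightarrow> 'p"
  where
  "sceptic_moves \<sigma> \<gamma>1 \<gamma>2 \<omega> n = \<sigma> (history \<sigma> \<gamma>1 \<gamma>2 \<omega> (n - 1)) (\<gamma>1 n) (\<gamma>2 n)"

(* The arguments of the property P are the moves of Predictor 1, Predictor 2, Sceptic
   and Nature. *)
definition guarantees ::
    "('o, 'p) game \<Rightarrow> ('o, 'p) strategy \<Rightarrow>
     ((nat \<Rightarrow> 'p) \<Rightarrow> (nat \<Rightarrow> 'p) \<Rightarrow> (nat \<Rightarrow> 'p) \<Rightarrow> (nat \<Rightarrow> 'o) \<Rightarrow> bool) \<Rightarrow> bool"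
  where
  "guarantees G \<sigma> P \<longleftrightarrow>
     (\<forall>\<gamma>1 \<gamma>2 \<omega>.
        (\<forall>n\<ge>1. \<gamma>1 n \<in> predictions G \<and> \<gamma>2 n \<in> predictions G \<and> \<omega> n \<in> outcomes G) \<longrightarrow>
        P \<gamma>1 \<gamma>2 (sceptic_moves \<sigma> \<gamma>1 \<gamma>2 \<omega>) \<omega>)"

definition cumulative_loss ::
    "('o, 'p) game \<Rightarrow> (nat \<Rightarrow> 'o) \<Rightarrow> (nat \<Rightarrow> 'p) \<Rightarrow> nat \<Rightarrow> real" where
  "cumulative_loss G \<omega> \<gamma> N = (\<Sum>n=1..N. loss G (\<omega> n) (\<gamma> n))"

definition square_loss_game :: "(real, real) game" where
  "square_loss_game =
     \<lparr>outcomes = UNIV, predictions = UNIV, loss = (\<lambda>\<omega> \<gamma>. (\<omega> - \<gamma>)\<^sup>2)\<rparr>"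

end

theory Submission
  imports Defs
begin

text \<open>
  Let \<open>M\<close> be the larger of \<open>L1 - Ls\<close> and \<open>L2 - Ls\<close>, where \<open>Ls\<close> is Sceptic's loss, and let
  \<open>D = L1 - L2\<close>. For \<open>c > 0\<close> the function \<open>height c D - \<bar>D\<bar> / 2\<close> is concave in \<open>D\<close>, so if Sceptic
  mixes the two predictions with the weight \<open>t\<close> given by its slope at \<open>D\<close>, then \<open>M - height c D\<close>
  grows in every round by at least \<open>t (1 - t) d\<^sup>2\<close>, \<open>d\<close> being the distance of the predictions. As
  soon as the height reaches 2, Sceptic replaces \<open>c\<close> by a value that reduces the height to at most
  1, and \<open>M - height c D\<close> grows by another 1. If \<open>M - height c D\<close> is unbounded, then \<open>M\<close> diverges,
  as heights are nonnegative. Otherwise \<open>c\<close> is eventually constant and the height stays below 2,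
  so \<open>D\<close> is bounded, \<open>t (1 - t)\<close> is bounded away from 0, and \<open>d\<close> tends to 0.
\<close>

text \<open>The nonnegative root \<open>h\<close> of
  \<open>h^2 + 2 * c * h = c * \<bar>D\<bar>\<close>. For \<open>c > 0\<close> its one-sided slopes
  at 0 are 1/2 and -1/2, so subtracting \<open>\<bar>D\<bar> / 2\<close> removes the kink.\<close>

definition height :: "real \<Rightarrow> real \<Rightarrow> real" where
  "height c D = sqrt (c\<^sup>2 + c * \<bar>D\<bar>) - c"

text \<open>One half minus the slope of \<open>height c D - \<bar>D\<bar> / 2\<close>. The larger
  weight goes to the predictor with the larger cumulative loss.\<close>

definition weight :: "real \<Rightarrow> real \<Rightarrow> real" where
  "weight c D = (let s = c / (2 * sqrt (c\<^sup>2 + c * \<bar>D\<bar>)) in if D \<ge> 0 then 1 - s else s)"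

definition rescale :: "real \<Rightarrow> real \<Rightarrow> real" where
  "rescale c D = (if height c D < 2 then c else 1 / (1 + \<bar>D\<bar>))"

lemma rescale_pos: "c > 0 \<Longrightarrow> rescale c D > 0"
  by (auto simp: rescale_def)

lemma sqrt_ge_scale:
  assumes "c > 0"
  shows "c \<le> sqrt (c\<^sup>2 + c * \<bar>D\<bar>)"
  using assms by (intro real_le_rsqrt) auto

lemma height_nonneg: "c > 0 \<Longrightarrow> height c D \<ge> 0"
  using sqrt_ge_scale[of c D] by (simp add: height_def)

text \<open>With this scale the product \<open>c * \<bar>D\<bar>\<close> is at most 1, so the
  radicand is at most \<open>(c + 1)^2\<close>.\<close>

lemma height_reset: "height (1 / (1 + \<bar>D\<bar>)) D \<le> 1"
proof -
  define c where "c = 1 / (1 + \<bar>D\<bar>)"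
  have c: "c > 0" "c * \<bar>D\<bar> \<le> 1"
    by (auto simp: c_def field_simps)
  have "sqrt (c\<^sup>2 + c * \<bar>D\<bar>) \<le> c + 1"
    using c by (intro real_le_lsqrt) (auto simp: power2_sum)
  then show ?thesis
    by (simp add: height_def c_def)
qed

lemma height_rescale:
  assumes "c > 0"
  shows "height (rescale c D) D \<le> height c D - (if height c D < 2 then 0 else 1)"
  using height_reset[of D] by (auto simp: rescale_def)

lemma height_tangent:
  assumes "c > 0"
  shows "height c E - \<bar>E\<bar> / 2 \<le> height c D - \<bar>D\<bar> / 2 + (1 / 2 - weight c D) * (E - D)"
proof -
  define r where "r = sqrt (c\<^sup>2 + c * \<bar>D\<bar>)"
  define r' where "r' = sqrt (c\<^sup>2 + c * \<bar>E\<bar>)"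
  define s where "s = c / (2 * r)"
  have r: "c \<le> r"
    unfolding r_def by (rule sqrt_ge_scale[OF assms])
  then have "r > 0"
    using assms by simp
  have sq: "r\<^sup>2 = c\<^sup>2 + c * \<bar>D\<bar>" "r'\<^sup>2 = c\<^sup>2 + c * \<bar>E\<bar>"
    using assms by (auto simp: r_def r'_def)
  have s: "s \<le> 1 / 2"
    using r \<open>r > 0\<close> assms by (simp add: s_def field_simps)
  have w: "weight c D = (if D \<ge> 0 then 1 - s else s)"
    by (simp add: weight_def s_def r_def)
  \<comment> \<open>The inequality \<open>2 * r * r' \<le> r^2 + r'^2\<close>; divided by
    \<open>2 * r\<close> it puts the square root below its tangent.\<close>
  have "2 * r * r' \<le> 2 * r\<^sup>2 + c * (\<bar>E\<bar> - \<bar>D\<bar>)"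
    using sq sum_squares_bound[of r r'] by (simp add: algebra_simps)
  then have "r' - r \<le> s * (\<bar>E\<bar> - \<bar>D\<bar>)"
    using \<open>r > 0\<close> by (simp add: s_def field_simps power2_eq_square)
  then have "height c E - \<bar>E\<bar> / 2 \<le> height c D - \<bar>D\<bar> / 2 + (s - 1 / 2) * (\<bar>E\<bar> - \<bar>D\<bar>)"
    unfolding height_def r_def[symmetric] r'_def[symmetric] by (simp add: field_simps)
  \<comment> \<open>As \<open>s - 1 / 2\<close> is not positive, \<open>\<bar>E\<bar>\<close> can be
    replaced by \<open>E\<close> or \<open>-E\<close>, according to the sign of
    \<open>D\<close>.\<close>
  also have "(s - 1 / 2) * (\<bar>E\<bar> - \<bar>D\<bar>) \<le> (1 / 2 - weight c D) * (E - D)"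
  proof (cases "D \<ge> 0")
    case True
    have "(s - 1 / 2) * (\<bar>E\<bar> - \<bar>D\<bar>) \<le> (s - 1 / 2) * (E - D)"
      using s True by (intro mult_left_mono_neg) auto
    then show ?thesis
      using True by (simp add: w algebra_simps)
  next
    case False
    have "(s - 1 / 2) * (\<bar>E\<bar> - \<bar>D\<bar>) \<le> (s - 1 / 2) * (D - E)"
      using s False by (intro mult_left_mono_neg) auto
    then show ?thesis
      using False by (simp add: w field_simps)
  qed
  finally show ?thesis
    by simp
qed

text \<open>Since \<open>height c D + c\<close> is the square root itself, the left side is
  \<open>s / 2\<close>, where \<open>s\<close> is the smaller of the two weights; the other one is
  at least 1/2.\<close>

lemma weight_variance_ge:
  assumes "c > 0"
  shows "c / (4 * (height c D + c)) \<le> weight c D * (1 - weight c D)"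
proof -
  define r where "r = sqrt (c\<^sup>2 + c * \<bar>D\<bar>)"
  define s where "s = c / (2 * r)"
  have r: "c \<le> r"
    unfolding r_def by (rule sqrt_ge_scale[OF assms])
  then have "r > 0"
    using assms by simp
  have s: "s \<le> 1 / 2" "s \<ge> 0"
    using r \<open>r > 0\<close> assms by (auto simp: s_def field_simps)
  have "c / (4 * (height c D + c)) = s * (1 / 2)"
    by (simp add: height_def s_def r_def)
  also have "\<dots> \<le> s * (1 - s)"
    using s by (intro mult_left_mono) auto
  also have "\<dots> = weight c D * (1 - weight c D)"
    by (auto simp: weight_def Let_def s_def r_def)
  finally show ?thesis .
qed

text \<open>The maximum is the mean plus half the absolute difference. The part of the mean's change
  that is linear in the change of \<open>a - b\<close> has slope \<open>1 / 2 - t\<close>, which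
  pays for the tangent bound; the variance of the mixture remains.\<close>

lemma mixture_gain:
  fixes a b :: real
  assumes "c > 0" and t: "t = weight c (a - b)"
    and s: "s = t * p + (1 - t) * q"
    and a': "a' = a + (w - p)\<^sup>2 - (w - s)\<^sup>2" and b': "b' = b + (w - q)\<^sup>2 - (w - s)\<^sup>2"
  shows "max a' b' - height c (a' - b') \<ge> max a b - height c (a - b) + t * (1 - t) * (p - q)\<^sup>2"
proof -
  have max_eq: "max x y = (x + y) / 2 + \<bar>x - y\<bar> / 2" for x y :: real
    by (simp add: max_def field_simps)
  \<comment> \<open>The \<open>t\<close>-average of the square losses of \<open>p\<close> and
    \<open>q\<close> exceeds the loss of \<open>s\<close> by \<open>t * (1 - t) * (p - q)^2\<close>;
    passing to the plain average adds the linear term.\<close>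
  have "(a' + b') / 2 = (a + b) / 2 + (1 / 2 - t) * ((a' - b') - (a - b)) + t * (1 - t) * (p - q)\<^sup>2"
    unfolding a' b' s by (simp add: field_simps power2_eq_square)
  then show ?thesis
    using height_tangent[OF assms(1), of "a' - b'" "a - b"] unfolding max_eq t by linarith
qed

text \<open>A strategy sees only the history, so the state, the loss difference and the current
  scale, is recomputed by folding over past rounds.\<close>

definition update :: "(real, real) round \<Rightarrow> real \<times> real \<Rightarrow> real \<times> real" where
  "update = (\<lambda>(p, q, s, w) (D, c). let E = D + (w - p)\<^sup>2 - (w - q)\<^sup>2 in (E, rescale c E))"

definition mixing_strategy :: "(real, real) strategy" where
  "mixing_strategy h p q =
     (let (D, c) = fold update h (0, 1); t = weight c D in t * p + (1 - t) * q)"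

text \<open>Here \<open>S\<close> is the maximum minus the height \<open>H\<close>, and
  \<open>K\<close> is the height after a round but before rescaling. \<open>S\<close> increases, so
  it either diverges or converges; in the latter case its increments tend to 0 and control
  \<open>g\<close>.\<close>

lemma increasing_gain_dichotomy:
  fixes S g c H :: "nat \<Rightarrow> real"
  assumes gain: "\<And>n. S (Suc n) \<ge> S n + c n / (4 * (H n + c n)) * (g (Suc n))\<^sup>2
                        + (if K n < 2 then 0 else 1)"
    and c_pos: "\<And>n. c n > 0" and H_nonneg: "\<And>n. H n \<ge> 0"
    and c_keep: "\<And>n. K n < 2 \<Longrightarrow> c (Suc n) = c n \<and> H (Suc n) = K n"
  shows "g \<longlonglongrightarrow> 0 \<or> filterlim S at_top sequentially"
proof -
  have step: "S n + c n / (4 * (H n + c n)) * (g (Suc n))\<^sup>2 \<le> S (Suc n)"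
    and jump: "K n \<ge> 2 \<Longrightarrow> S n + 1 \<le> S (Suc n)"
    and mono: "S n \<le> S (Suc n)" for n :: nat
  proof -
    have "c n / (4 * (H n + c n)) * (g (Suc n))\<^sup>2 \<ge> 0"
      using c_pos[of n] H_nonneg[of n] by simp
    then show "S n + c n / (4 * (H n + c n)) * (g (Suc n))\<^sup>2 \<le> S (Suc n)"
      "K n \<ge> 2 \<Longrightarrow> S n + 1 \<le> S (Suc n)" "S n \<le> S (Suc n)"
      using gain[of n] by (auto split: if_splits)
  qed
  have inc: "incseq S"
    using mono by (rule incseq_SucI)
  show ?thesis
  proof (cases "\<exists>B. \<forall>n. S n \<le> B")
    case False
    have "filterlim S at_top sequentially"
      unfolding filterlim_at_top
    proof
      fix Z
      obtain n where "Z \<le> S n"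
        using False by (meson le_cases)
      then show "\<forall>\<^sub>F n in sequentially. Z \<le> S n"
        using inc by (intro eventually_sequentiallyI[of n]) (meson incseqD order_trans)
    qed
    then show ?thesis ..
  next
    case True
    then obtain B where B: "\<And>n. S n \<le> B"
      by blast
    obtain l where l: "S \<longlonglongrightarrow> l"
      using incseq_convergent[OF inc] B by blast
    then have diff: "(\<lambda>n. S (Suc n) - S n) \<longlonglongrightarrow> 0"
      using tendsto_diff[OF LIMSEQ_Suc[OF l] l] by simp
    \<comment> \<open>Each rescaling raises \<open>S\<close> by at least 1, so from some
      \<open>n0\<close> on none occurs.\<close>
    then have "\<forall>\<^sub>F n in sequentially. S (Suc n) - S n < 1"
      by (rule order_tendstoD) simp
    then obtain n0 where n0: "\<And>n. n \<ge> n0 \<Longrightarrow> K n < 2"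
      using jump unfolding eventually_sequentially
      by (metis add.commute le_diff_eq linorder_not_less)
    define C where "C = c n0"
    \<comment> \<open>The coefficient of the gain at height 2, a lower bound for it at smaller
      heights.\<close>
    define \<kappa> where "\<kappa> = C / (4 * (2 + C))"
    have C: "c n = C" if "n \<ge> n0" for n
      using that by (induction n rule: dec_induct) (use n0 c_keep in \<open>auto simp: C_def\<close>)
    have \<kappa>: "\<kappa> > 0"
      using c_pos[of n0] by (simp add: \<kappa>_def C_def)
    \<comment> \<open>The index starts one later because \<open>H n < 2\<close> is read off from
      \<open>K\<close> in the preceding round.\<close>
    have bound: "norm ((g (Suc n))\<^sup>2) \<le> (S (Suc n) - S n) / \<kappa>" if n: "n \<ge> Suc n0" for n
    proof -
      obtain m where m: "n = Suc m" "m \<ge> n0"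
        using n by (metis Suc_le_D Suc_le_mono)
      have "H n < 2"
        using c_keep[of m] n0[of m] m by simp
      then have "\<kappa> \<le> c n / (4 * (H n + c n))"
        using C[of n] n c_pos[of n] H_nonneg[of n]
        unfolding \<kappa>_def by (simp add: field_simps)
      then have "\<kappa> * (g (Suc n))\<^sup>2 \<le> S (Suc n) - S n"
        using step[of n] mult_right_mono[of \<kappa> _ "(g (Suc n))\<^sup>2"] by fastforce
      then show ?thesis
        using \<kappa> by (simp add: field_simps)
    qed
    have "(\<lambda>n. (g (Suc n))\<^sup>2) \<longlonglongrightarrow> 0"
    proof (rule Lim_null_comparison)
      show "\<forall>\<^sub>F n in sequentially. norm ((g (Suc n))\<^sup>2) \<le> (S (Suc n) - S n) / \<kappa>"
        using bound by (auto simp: eventually_sequentially)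
      show "(\<lambda>n. (S (Suc n) - S n) / \<kappa>) \<longlonglongrightarrow> 0"
        using tendsto_divide[OF diff tendsto_const[of \<kappa>]] \<kappa> by simp
    qed
    then have "(\<lambda>n. g (Suc n)) \<longlonglongrightarrow> 0"
      using tendsto_null_power by fastforce
    then show ?thesis
      using LIMSEQ_imp_Suc by blast
  qed
qed

lemma mixing_strategy_dichotomy:
  fixes p q w :: "nat \<Rightarrow> real"
  defines "s \<equiv> sceptic_moves mixing_strategy p q w"
  defines "a \<equiv> \<lambda>N. cumulative_loss square_loss_game w p N - cumulative_loss square_loss_game w s N"
  defines "b \<equiv> \<lambda>N. cumulative_loss square_loss_game w q N - cumulative_loss square_loss_game w s N"
  shows "(\<lambda>N. \<bar>p N - q N\<bar>) \<longlonglongrightarrow> 0 \<or> filterlim (\<lambda>N. max (a N) (b N)) at_top sequentially"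
proof -
  define st where "st n = fold update (history mixing_strategy p q w n) (0, 1)" for n
  define c where "c n = snd (st n)" for n
  have loss_Suc: "cumulative_loss square_loss_game w x (Suc n) =
      cumulative_loss square_loss_game w x n + (w (Suc n) - x (Suc n))\<^sup>2" for x n
    by (simp add: cumulative_loss_def square_loss_game_def)
  have ab_Suc: "a (Suc n) = a n + (w (Suc n) - p (Suc n))\<^sup>2 - (w (Suc n) - s (Suc n))\<^sup>2"
      "b (Suc n) = b n + (w (Suc n) - q (Suc n))\<^sup>2 - (w (Suc n) - s (Suc n))\<^sup>2" for n
    by (simp_all add: a_def b_def loss_Suc)
  have st_Suc: "st (Suc n) =
      update (p (Suc n), q (Suc n), s (Suc n), w (Suc n)) (st n)" for n
    by (simp add: st_def Let_def s_def sceptic_moves_def)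
  \<comment> \<open>Sceptic's loss cancels in \<open>a n - b n\<close>, so the folded state tracks
    this difference.\<close>
  have st_eq: "st n = (a n - b n, c n)" for n
  proof (induction n)
    case 0
    show ?case
      by (simp add: c_def st_def a_def b_def cumulative_loss_def)
  next
    case (Suc n)
    have "fst (st (Suc n)) = a (Suc n) - b (Suc n)"
      unfolding st_Suc Suc.IH ab_Suc by (simp add: update_def Let_def)
    then show ?case
      unfolding c_def by (metis prod.collapse)
  qed
  have c_Suc: "c (Suc n) = rescale (c n) (a (Suc n) - b (Suc n))" for n
  proof -
    have "c (Suc n) = snd (update (p (Suc n), q (Suc n), s (Suc n), w (Suc n)) (a n - b n, c n))"
      unfolding st_eq[symmetric] st_Suc[symmetric] by (rule c_def)
    then show ?thesis
      unfolding ab_Suc by (simp add: update_def Let_def algebra_simps)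
  qed
  have c_pos: "c n > 0" for n
    by (induction n) (simp_all add: c_def[of 0] st_def c_Suc rescale_pos)
  define t where "t n = weight (c n) (a n - b n)" for n
  have s_Suc: "s (Suc n) = t n * p (Suc n) + (1 - t n) * q (Suc n)" for n
    using st_eq[of n] by (simp add: s_def sceptic_moves_def mixing_strategy_def st_def t_def Let_def)
  define H where "H n = height (c n) (a n - b n)" for n
  define K where "K n = height (c n) (a (Suc n) - b (Suc n))" for n
  define S where "S n = max (a n) (b n) - H n" for n
  have "S n + c n / (4 * (H n + c n)) * \<bar>p (Suc n) - q (Suc n)\<bar>\<^sup>2 + (if K n < 2 then 0 else 1)
      \<le> S (Suc n)" for n
  proof -
    have "c n / (4 * (H n + c n)) * \<bar>p (Suc n) - q (Suc n)\<bar>\<^sup>2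
        \<le> t n * (1 - t n) * (p (Suc n) - q (Suc n))\<^sup>2"
      unfolding H_def t_def power2_abs
      using weight_variance_ge[OF c_pos] by (intro mult_right_mono) auto
    moreover have "S n + t n * (1 - t n) * (p (Suc n) - q (Suc n))\<^sup>2
        \<le> max (a (Suc n)) (b (Suc n)) - K n"
      unfolding S_def H_def K_def using mixture_gain[OF c_pos t_def s_Suc ab_Suc] .
    moreover have "H (Suc n) \<le> K n - (if K n < 2 then 0 else 1)"
      unfolding H_def K_def c_Suc by (rule height_rescale[OF c_pos])
    ultimately show ?thesis
      by (simp add: S_def)
  qed
  moreover have "H n \<ge> 0" for n
    unfolding H_def by (rule height_nonneg[OF c_pos])
  moreover have "c (Suc n) = c n \<and> H (Suc n) = K n" if "K n < 2" for n
    using that by (simp add: H_def K_def c_Suc rescale_def)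
  ultimately have "(\<lambda>N. \<bar>p N - q N\<bar>) \<longlonglongrightarrow> 0 \<or> filterlim S at_top sequentially"
    using c_pos by (intro increasing_gain_dichotomy[where c = c and H = H and K = K]) auto
  \<comment> \<open>Heights are nonnegative, so \<open>S\<close> is a lower bound for the
    maximum.\<close>
  moreover have "filterlim (\<lambda>N. max (a N) (b N)) at_top sequentially"
    if "filterlim S at_top sequentially"
    using that by (rule filterlim_at_top_mono)
      (simp add: S_def H_def height_nonneg[OF c_pos])
  ultimately show ?thesis
    by blast
qed

theorem proposition2:
  shows "\<exists>\<sigma>. sceptic_strategy square_loss_game \<sigma> \<and>
    guarantees square_loss_game \<sigma>
      (\<lambda>\<gamma>1 \<gamma>2 \<gamma>s \<omega>.
        (\<lambda>N. \<bar>\<gamma>1 N - \<gamma>2 N\<bar>) \<longlonglongrightarrow> 0 \<or>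
        filterlim
          (\<lambda>N. max
            (cumulative_loss square_loss_game \<omega> \<gamma>1 N - cumulative_loss square_loss_game \<omega> \<gamma>s N)
            (cumulative_loss square_loss_game \<omega> \<gamma>2 N - cumulative_loss square_loss_game \<omega> \<gamma>s N))
          at_top sequentially)"
proof (intro exI conjI)
  show "sceptic_strategy square_loss_game mixing_strategy"
    by (simp add: sceptic_strategy_def square_loss_game_def)
qed (simp add: guarantees_def mixing_strategy_dichotomy)

end
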